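(* For every $j\in\mathbb{Z}$ let $h_{1,j}(\tau):=\theta_{1,j+1}(\tau)$. Recursively, for $\ell\in\mathbb{Z}_{>0}$, assuming $h_{\ell,c}$ is defined for $0\le c\le 2\ell$, define for each $0\le b\le \ell+1$ $$h_{\ell+1,b}:=h_{1,b}\,\theta_{\ell(\ell+1),b\ell}\,h_{\ell,0}+h_{1,b-\ell}\,\theta_{\ell(\ell+1),b\ell-\ell(\ell+1)}\,h_{\ell,\ell}+\sum_{c=1}^{\ell-1}h_{1,b-c}\big(\theta_{\ell(\ell+1),b\ell-c(\ell+1)}+\theta_{\ell(\ell+1),b\ell+c(\ell+1)}\big)h_{\ell,c},$$ and set $h_{\ell+1,b}:=h_{\ell+1,2\ell+2-b}$ for $\ell+1<b\le 2\ell+2$; and for every integer $b$ define $$h_{\ell+\frac12,b+\frac12}:=\sum_{c=0}^{2\ell-1}h_{\ell,c}\,\theta_{\ell(2\ell+1),\,c(2\ell+1)-\ell(2b+1)}$$ (all functions evaluated at $\tau$). Then for all $\ell\in\mathbb{Z}_{>0}$ and $\delta\in\{0,1\}$, $$(-1)^\delta\,\vartheta\Big(z+\frac12;\tau\Big)^{2\ell+\delta}=\sum_{b=0}^{2\ell+\delta-1}h_{\ell+\frac\delta2,b+\frac\delta2}(\tau)\,\vartheta_{\ell+\frac\delta2,b+\frac\delta2}(z;\tau).$$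
   Context: $q=e^{2\pi i\tau}$, $\zeta=e^{2\pi iz}$, $\tau$ in the upper half-plane, $q^x:=e^{2\pi i x\tau}$, $\zeta^x:=e^{2\pi i x z}$. The Jacobi theta function is $\vartheta(z;\tau):=\sum_{n\in\frac12+\mathbb{Z}}e^{\pi i n^2\tau+2\pi i n(z+\frac12)}$. For $m\in\frac12\mathbb{Z}_{>0}$ and $a\in\frac12\mathbb{Z}$ put $\vartheta_{m,a}(z;\tau):=\sum_{n\in\mathbb{Z}}q^{\frac{(2mn+a)^2}{4m}}\zeta^{2mn+a}$ and $\theta_{m,a}(\tau):=\vartheta_{m,a}(0;\tau)=\sum_{n\in\mathbb{Z}}q^{\frac{(2mn+a)^2}{4m}}$. *)

theory Defs
  imports "HOL-Analysis.Analysis"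
begin

text \<open>The real power \<open>q\<^sup>x\<close> of \<open>q = e\<^bsup>2\<pi>i\<tau>\<^esup>\<close>, read off from \<open>\<tau>\<close> (no branch of a logarithm
  is involved). It also gives \<open>\<zeta>\<^sup>x\<close> for \<open>\<zeta> = e\<^bsup>2\<pi>iz\<^esup>\<close>, as \<open>epow z x\<close>.\<close>

definition epow :: "complex \<Rightarrow> real \<Rightarrow> complex" where
  "epow \<tau> x = exp (2 * of_real pi * \<i> * of_real x * \<tau>)"

definition jacobi_vartheta :: "complex \<Rightarrow> complex \<Rightarrow> complex" where
  "jacobi_vartheta z \<tau> =
     (\<Sum>\<^sub>\<infinity>n\<in>{n::real. n - 1/2 \<in> \<int>}.
        exp (of_real pi * \<i> * of_real (n\<^sup>2) * \<tau> + 2 * of_real pi * \<i> * of_real n * (z + 1/2)))"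

text \<open>The parameters \<open>m\<close> and \<open>a\<close> are meant to be half-integers, with \<open>m > 0\<close>.\<close>

definition vartheta :: "real \<Rightarrow> real \<Rightarrow> complex \<Rightarrow> complex \<Rightarrow> complex" where
  "vartheta m a z \<tau> =
     (\<Sum>\<^sub>\<infinity>n\<in>(UNIV :: int set).
        epow \<tau> ((2 * m * of_int n + a)\<^sup>2 / (4 * m)) * epow z (2 * m * of_int n + a))"

definition theta :: "real \<Rightarrow> real \<Rightarrow> complex \<Rightarrow> complex" where
  "theta m a \<tau> = vartheta m a 0 \<tau>"

definition h_one :: "int \<Rightarrow> complex \<Rightarrow> complex" where
  "h_one j \<tau> = theta 1 (of_int (j + 1)) \<tau>"

text \<open>The right-hand side of the recursion for \<open>h\<^bsub>l+1,b\<^esub>\<close>; the argument \<open>hl\<close> stands for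
  \<open>c \<mapsto> h\<^bsub>l,c\<^esub>(\<tau>)\<close>.\<close>

definition h_step :: "int \<Rightarrow> (int \<Rightarrow> complex) \<Rightarrow> int \<Rightarrow> complex \<Rightarrow> complex" where
  "h_step l hl b \<tau> =
     h_one b \<tau> * theta (of_int (l * (l + 1))) (of_int (b * l)) \<tau> * hl 0
   + h_one (b - l) \<tau> * theta (of_int (l * (l + 1))) (of_int (b * l - l * (l + 1))) \<tau> * hl l
   + (\<Sum>c = 1..l - 1. h_one (b - c) \<tau>
        * (theta (of_int (l * (l + 1))) (of_int (b * l - c * (l + 1))) \<tau>
           + theta (of_int (l * (l + 1))) (of_int (b * l + c * (l + 1))) \<tau>)
        * hl c)"

text \<open>\<open>h_int l b \<tau>\<close> is \<open>h\<^bsub>l,b\<^esub>(\<tau>)\<close> for integers \<open>l > 0\<close>: for all \<open>b\<close> if \<open>l = 1\<close>, and for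
  \<open>0 \<le> b \<le> 2l\<close> if \<open>l > 1\<close>. The value \<open>0\<close> elsewhere is a dummy that is never used.\<close>

fun h_int :: "nat \<Rightarrow> int \<Rightarrow> complex \<Rightarrow> complex" where
  "h_int 0 b \<tau> = 0"
| "h_int (Suc 0) b \<tau> = h_one b \<tau>"
| "h_int (Suc (Suc k)) b \<tau> =
     (let l = int (Suc k); hl = (\<lambda>c. h_int (Suc k) c \<tau>) in
      if 0 \<le> b \<and> b \<le> l + 1 then h_step l hl b \<tau>
      else if l + 1 < b \<and> b \<le> 2 * l + 2 then h_step l hl (2 * l + 2 - b) \<tau>
      else 0)"

text \<open>\<open>h_half l b \<tau>\<close> is \<open>h\<^bsub>l+1/2,b+1/2\<^esub>(\<tau>)\<close>.\<close>

definition h_half :: "nat \<Rightarrow> int \<Rightarrow> complex \<Rightarrow> complex" where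
  "h_half l b \<tau> =
     (\<Sum>c = 0..2 * int l - 1.
        h_int l c \<tau>
        * theta (of_int (int l * (2 * int l + 1)))
                (of_int (c * (2 * int l + 1) - int l * (2 * b + 1))) \<tau>)"

text \<open>The combined family \<open>h\<^bsub>m,a\<^esub>\<close>, for \<open>m\<close>, \<open>a\<close> both integers or both in \<open>1/2 + \<int>\<close>.\<close>

definition h :: "real \<Rightarrow> real \<Rightarrow> complex \<Rightarrow> complex" where
  "h m a \<tau> = (if m \<in> \<int> then h_int (nat \<lfloor>m\<rfloor>) \<lfloor>a\<rfloor> \<tau> else h_half (nat \<lfloor>m\<rfloor>) \<lfloor>a\<rfloor> \<tau>)"

end

theory Submission
  imports Defs
begin

text \<open>With \<open>g\<^sub>m(x) = q\<^bsup>x\<^sup>2/4m\<^esup> \<zeta>\<^sup>x\<close>, all series in sight are sums of \<open>g\<^sub>m\<close> over shifted arithmetic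
  progressions, and completing the square gives
  \<open>g\<^sub>m(r) g\<^sub>n(s) = g\<^bsub>m+n\<^esub>(r + s) q\<^bsup>(nr-ms)\<^sup>2/4mn(m+n)\<^esup>\<close>. Collecting the terms with \<open>r + s = N\<close> in a
  product of two combinations \<open>\<Sum> A\<^sub>b \<vartheta>\<^bsub>m,b\<^esub>\<close> and \<open>\<Sum> B\<^sub>c \<vartheta>\<^bsub>n,c\<^esub>\<close> with periodic coefficients thus yields
  a combination of the \<open>\<vartheta>\<^bsub>m+n,N\<^esub>\<close>, whose coefficients are theta constants once \<open>s\<close> is split into
  residue classes modulo \<open>2n\<close>. As \<open>\<vartheta>(z + 1/2) = - \<vartheta>\<^bsub>1/2,1/2\<^esub>(z)\<close>, squaring gives the case \<open>l = 1\<close>;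
  multiplying by the square (\<open>m = 1\<close>) gives the recursion, after folding \<open>c \<mapsto> 2l - c\<close>; and
  multiplying by one further factor (\<open>m = 1/2\<close>) gives the odd powers.\<close>

section \<open>Convolution and residue classes of infinite sums\<close>

text \<open>Absolute summability of both factors makes the double family \<open>f r * g s\<close>
  summable, so it can be rearranged along the lines \<open>r + s = N\<close>.\<close>

lemma infsum_convolution:
  fixes f g :: "'a::ab_group_add \<Rightarrow> 'b::{real_normed_field,banach}"
  assumes f: "(\<lambda>x. norm (f x)) summable_on UNIV" and g: "(\<lambda>x. norm (g x)) summable_on UNIV"
  shows "(\<lambda>s. f (N - s) * g s) summable_on UNIV"
    and "infsum f UNIV * infsum g UNIV = (\<Sum>\<^sub>\<infinity>N. \<Sum>\<^sub>\<infinity>s. f (N - s) * g s)"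
proof -
  define F where "F = (\<lambda>(r, s). f r * g s)"
  have "(\<lambda>x. norm (F x)) summable_on UNIV \<times> UNIV"
    unfolding Infinite_Sum.abs_summable_on_Sigma_iff
  proof (intro conjI ballI)
    show "(\<lambda>s. norm (F (r, s))) summable_on UNIV" for r
      using g by (simp add: F_def norm_mult summable_on_cmult_right)
    have "(\<lambda>r. norm (norm (f r) * (\<Sum>\<^sub>\<infinity>s. norm (g s)))) summable_on UNIV"
      using summable_on_cmult_left[OF f, of "\<bar>\<Sum>\<^sub>\<infinity>s. norm (g s)\<bar>"]
      by (simp add: abs_mult)
    then show "(\<lambda>r. norm (\<Sum>\<^sub>\<infinity>s. norm (F (r, s)))) summable_on UNIV"
      by (simp add: F_def norm_mult infsum_cmult_right')
  qed
  then have F: "F summable_on UNIV \<times> UNIV"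
    by (rule Infinite_Sum.abs_summable_summable)
  define G where "G = (\<lambda>(N, s). F (N - s, s))"
  have bij: "bij_betw (\<lambda>(N, s). (N - s, s)) (UNIV \<times> UNIV :: ('a \<times> 'a) set) (UNIV \<times> UNIV)"
    by (rule bij_betw_byWitness[where f' = "\<lambda>(r, s). (r + s, s)"]) auto
  have G_alt: "G = (\<lambda>x. F ((\<lambda>(N, s). (N - s, s)) x))"
    by (simp add: G_def fun_eq_iff)
  have G: "G summable_on UNIV \<times> UNIV"
    unfolding G_alt using F by (rule summable_on_reindex_bij_betw[OF bij, THEN iffD2])
  show "(\<lambda>s. f (N - s) * g s) summable_on UNIV"
  proof -
    have "G summable_on range (Pair N)"
      using G by (rule summable_on_subset_banach) auto
    then show ?thesis
      by (simp add: summable_on_reindex inj_on_def o_def G_def F_def)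
  qed
  have "infsum f UNIV * infsum g UNIV = (\<Sum>\<^sub>\<infinity>r. \<Sum>\<^sub>\<infinity>s. F (r, s))"
    by (simp add: F_def infsum_cmult_right' infsum_cmult_left')
  also have "\<dots> = infsum F (UNIV \<times> UNIV)"
    by (rule infsum_Sigma_banach[OF F])
  also have "\<dots> = infsum G (UNIV \<times> UNIV)"
    unfolding G_alt by (rule infsum_reindex_bij_betw[OF bij, symmetric])
  also have "\<dots> = (\<Sum>\<^sub>\<infinity>N. \<Sum>\<^sub>\<infinity>s. G (N, s))"
    by (rule infsum_Sigma_banach[OF G, symmetric])
  finally show "infsum f UNIV * infsum g UNIV = (\<Sum>\<^sub>\<infinity>N. \<Sum>\<^sub>\<infinity>s. f (N - s) * g s)"
    by (simp add: G_def F_def)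
qed

lemma infsum_residue_classes:
  fixes f :: "int \<Rightarrow> 'b::banach"
  assumes f: "f summable_on UNIV" and p: "p > 0"
  shows "infsum f UNIV = (\<Sum>b=0..<p. \<Sum>\<^sub>\<infinity>k. f (p * k + b))"
proof -
  have bij: "bij_betw (\<lambda>(b, k). p * k + b) ({0..<p} \<times> UNIV) UNIV"
    by (rule bij_betw_byWitness[where f' = "\<lambda>n. (n mod p, n div p)"]) (use p in auto)
  have "infsum f UNIV = (\<Sum>\<^sub>\<infinity>x\<in>{0..<p} \<times> UNIV. f ((\<lambda>(b, k). p * k + b) x))"
    by (rule infsum_reindex_bij_betw[OF bij, symmetric])
  also have "\<dots> = (\<Sum>\<^sub>\<infinity>b\<in>{0..<p}. \<Sum>\<^sub>\<infinity>k. f (p * k + b))"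
    using summable_on_reindex_bij_betw[OF bij, of f] f
    by (subst infsum_Sigma_banach[symmetric]) auto
  finally show ?thesis
    by simp
qed

section \<open>Gaussian terms, their summability, and theta constants\<close>

definition gauss :: "real \<Rightarrow> complex \<Rightarrow> complex \<Rightarrow> real \<Rightarrow> complex" where
  "gauss m z \<tau> x = epow \<tau> (x\<^sup>2 / (4 * m)) * epow z x"

lemma vartheta_gauss: "vartheta m a z \<tau> = (\<Sum>\<^sub>\<infinity>n::int. gauss m z \<tau> (2 * m * of_int n + a))"
  by (simp add: vartheta_def gauss_def)

lemma epow_add: "epow \<tau> (x + y) = epow \<tau> x * epow \<tau> y"
  by (simp add: epow_def distrib_left distrib_right exp_add)

lemma epow_zero_left [simp]: "epow 0 x = 1"
  by (simp add: epow_def)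

lemma gauss_mult:
  assumes "m > 0" "n > 0"
  shows "gauss m z \<tau> r * gauss n z \<tau> s =
    gauss (m + n) z \<tau> (r + s) * gauss (m * n * (m + n)) 0 \<tau> (n * r - m * s)"
proof -
  define D where "D = 4 * (m * n * (m + n))"
  have D: "r\<^sup>2 / (4 * m) = n * (m + n) * r\<^sup>2 / D" "s\<^sup>2 / (4 * n) = m * (m + n) * s\<^sup>2 / D"
      "(r + s)\<^sup>2 / (4 * (m + n)) = m * n * (r + s)\<^sup>2 / D"
    using assms by (simp_all add: D_def)
  have "r\<^sup>2 / (4 * m) + s\<^sup>2 / (4 * n) = (r + s)\<^sup>2 / (4 * (m + n)) + (n * r - m * s)\<^sup>2 / D"
    unfolding D add_divide_distrib[symmetric]
    by (rule arg_cong[where f = "\<lambda>x. x / D"]) (simp add: power2_eq_square algebra_simps)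
  then have "epow \<tau> (r\<^sup>2 / (4 * m)) * epow \<tau> (s\<^sup>2 / (4 * n)) =
      epow \<tau> ((r + s)\<^sup>2 / (4 * (m + n))) * epow \<tau> ((n * r - m * s)\<^sup>2 / D)"
    by (simp flip: epow_add)
  then show ?thesis
    by (simp add: gauss_def D_def epow_add[of z] mult_ac)
qed

lemma gauss_zero_scale: "c \<noteq> 0 \<Longrightarrow> gauss (c\<^sup>2 * m) 0 \<tau> (c * x) = gauss m 0 \<tau> x"
  by (simp add: gauss_def epow_def power_mult_distrib)

lemma norm_gauss:
  "norm (gauss m z \<tau> x) = exp (- (2 * pi * Im \<tau> / (4 * m)) * x\<^sup>2 - 2 * pi * Im z * x)"
  by (simp add: gauss_def epow_def norm_mult norm_exp_eq_Re flip: exp_add)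

lemma summable_on_exp_abs_int: "(\<lambda>n. exp (- real_of_int \<bar>n\<bar>)) summable_on UNIV"
proof -
  have s: "(\<lambda>n. exp (- real n)) summable_on UNIV"
  proof (rule norm_summable_imp_summable_on)
    have "summable (\<lambda>n. exp (-1 :: real) ^ n)"
      by (rule summable_geometric) simp
    then show "summable (\<lambda>n. norm (exp (- real n)))"
      by (simp flip: exp_of_nat_mult)
  qed
  have "(\<lambda>n. exp (- real_of_int \<bar>n\<bar>)) summable_on range int"
    by (subst summable_on_reindex) (use s in \<open>auto simp: o_def\<close>)
  moreover have "(\<lambda>n. exp (- real_of_int \<bar>n\<bar>)) summable_on range (\<lambda>n. - int n - 1)"
  proof (subst summable_on_reindex)
    have "(\<lambda>n. exp (-1) * exp (- real n)) summable_on UNIV"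
      using s by (rule summable_on_cmult_right)
    then show "((\<lambda>n. exp (- real_of_int \<bar>n\<bar>)) \<circ> (\<lambda>n. - int n - 1)) summable_on UNIV"
      by (simp add: o_def flip: exp_add)
  qed (auto simp: inj_on_def)
  ultimately have "(\<lambda>n. exp (- real_of_int \<bar>n\<bar>)) summable_on range int \<union> range (\<lambda>n. - int n - 1)"
    by (rule summable_on_Un_disjoint) auto
  also have "range int \<union> range (\<lambda>n. - int n - 1) = UNIV"
  proof -
    have "n \<in> range int \<union> range (\<lambda>n. - int n - 1)" for n
      by (cases n) auto
    then show ?thesis
      by blast
  qed
  finally show ?thesis .
qed

lemma abs_summable_gauss:
  assumes "Im \<tau> > 0" "m > 0"
  shows "(\<lambda>j::int. norm (gauss m z \<tau> (of_int j + \<alpha>))) summable_on UNIV"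
proof -
  define A where "A = 2 * pi * Im \<tau> / (4 * m)"
  \<comment> \<open>The extra 1 in \<open>B\<close> leaves a factor exp(-|x|) for the comparison. In
    \<open>C\<close>, \<open>B\<^sup>2 / (4 * A)\<close> is the cost of completing the square and
    \<open>\<bar>\<alpha>\<bar>\<close> that of passing from \<open>j + \<alpha>\<close> to
    \<open>j\<close>.\<close>
  define B where "B = \<bar>2 * pi * Im z\<bar> + 1"
  define C where "C = B\<^sup>2 / (4 * A) + \<bar>\<alpha>\<bar>"
  have A: "A > 0"
    using assms by (simp add: A_def)
  have "norm (gauss m z \<tau> (of_int j + \<alpha>)) \<le> exp C * exp (- real_of_int \<bar>j\<bar>)" for j :: int
  proof -
    define x where "x = of_int j + \<alpha>"
    have "0 \<le> A * (\<bar>x\<bar> - B / (2 * A))\<^sup>2"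
      using A by simp
    also have "\<dots> = A * x\<^sup>2 - B * \<bar>x\<bar> + B\<^sup>2 / (4 * A)"
      using A by (simp add: power2_diff field_simps power2_eq_square)
    finally have "B * \<bar>x\<bar> \<le> A * x\<^sup>2 + B\<^sup>2 / (4 * A)"
      by simp
    moreover have "- (2 * pi * Im z * x) \<le> \<bar>2 * pi * Im z\<bar> * \<bar>x\<bar>"
      by (metis abs_ge_minus_self abs_mult)
    moreover have "\<bar>real_of_int j\<bar> \<le> \<bar>x\<bar> + \<bar>\<alpha>\<bar>"
      by (simp add: x_def)
    ultimately have "- A * x\<^sup>2 - 2 * pi * Im z * x \<le> C - \<bar>real_of_int j\<bar>"
      by (simp add: B_def C_def algebra_simps)
    then show ?thesis
      by (simp add: norm_gauss A_def x_def flip: exp_add)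
  qed
  then show ?thesis
    using summable_on_cmult_right[OF summable_on_exp_abs_int, of "exp C"]
    by (rule Infinite_Sum.abs_summable_on_comparison_test'[rotated])
qed

lemma vartheta_shift: "vartheta m (a + 2 * m * of_int k) z \<tau> = vartheta m a z \<tau>"
proof -
  have "bij (\<lambda>n::int. n + k)"
    by (rule bij_betw_byWitness[where f' = "\<lambda>n. n - k"]) auto
  from infsum_reindex_bij_betw[OF this, of "\<lambda>n. gauss m z \<tau> (2 * m * of_int n + a)"]
  show ?thesis
    by (simp add: vartheta_gauss algebra_simps)
qed

lemma theta_shift: "theta m (a + 2 * m * of_int k) \<tau> = theta m a \<tau>"
  by (simp add: theta_def vartheta_shift)

lemma gauss_zero_minus: "gauss m 0 \<tau> (- x) = gauss m 0 \<tau> x"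
  by (simp add: gauss_def)

lemma theta_minus: "theta m (- a) \<tau> = theta m a \<tau>"
proof -
  have "bij (\<lambda>n::int. - n)"
    by (rule bij_betw_byWitness[where f' = "\<lambda>n. - n"]) auto
  from infsum_reindex_bij_betw[OF this, of "\<lambda>n. gauss m 0 \<tau> (2 * m * of_int n - a)"]
  show ?thesis
    using gauss_zero_minus[of m \<tau> "2 * m * of_int n + a" for n :: int]
    by (simp add: theta_def vartheta_gauss)
qed

text \<open>A theta constant of parameter \<open>m\<close> needs a progression of step
  \<open>2 * m\<close>. For step \<open>2 * c * m\<close>, rescaling the argument by
  \<open>c\<close> restores this relation with parameter \<open>c\<^sup>2 * m\<close>.\<close>

lemma theta_scale: "c \<noteq> 0 \<Longrightarrow> theta (c\<^sup>2 * m) (c * a) \<tau> = (\<Sum>\<^sub>\<infinity>k::int. gauss m 0 \<tau> (2 * c * m * of_int k + a))"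
  by (subst gauss_zero_scale[of c, symmetric])
    (simp_all add: theta_def vartheta_gauss power2_eq_square algebra_simps)

section \<open>Series with periodic coefficients and their products\<close>

lemma abs_summable_periodic_gauss:
  assumes "Im \<tau> > 0" "m > 0" and p: "p > 0" and A: "\<And>j. A (j mod p) = (A j :: complex)"
  shows "(\<lambda>j::int. norm (A j * gauss m z \<tau> (of_int j + \<alpha>))) summable_on UNIV"
proof (rule Infinite_Sum.abs_summable_on_comparison_test')
  define C where "C = (\<Sum>b=0..<p. norm (A b))"
  show "(\<lambda>j::int. C * norm (gauss m z \<tau> (of_int j + \<alpha>))) summable_on UNIV"
    using assms by (intro summable_on_cmult_right abs_summable_gauss)
  show "norm (A j * gauss m z \<tau> (of_int j + \<alpha>)) \<le> C * norm (gauss m z \<tau> (of_int j + \<alpha>))" for j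
  proof -
    have "norm (A (j mod p)) \<le> C"
      unfolding C_def using p by (intro member_le_sum) auto
    then show ?thesis
      by (simp add: A norm_mult mult_right_mono)
  qed
qed

text \<open>As \<open>2 * m = p\<close>, the series \<open>vartheta m (b + \<alpha>)\<close> runs
  over the indices congruent to \<open>b\<close> modulo \<open>p\<close>, where a
  \<open>p\<close>-periodic coefficient is constant. The single series is the form to which
  convolution applies.\<close>

lemma sum_vartheta_eq_infsum:
  assumes "Im \<tau> > 0" and p: "p > 0" "of_int p = 2 * m" and A: "\<And>j. A (j mod p) = (A j :: complex)"
  shows "(\<Sum>b=0..<p. A b * vartheta m (of_int b + \<alpha>) z \<tau>) =
    (\<Sum>\<^sub>\<infinity>j::int. A j * gauss m z \<tau> (of_int j + \<alpha>))"
proof -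
  have "m > 0"
    using p by linarith
  then have "(\<lambda>j::int. A j * gauss m z \<tau> (of_int j + \<alpha>)) summable_on UNIV"
    using assms by (intro Infinite_Sum.abs_summable_summable[OF abs_summable_periodic_gauss[where p = p]])
  from infsum_residue_classes[OF this p(1)]
  have "(\<Sum>\<^sub>\<infinity>j::int. A j * gauss m z \<tau> (of_int j + \<alpha>)) =
      (\<Sum>b=0..<p. \<Sum>\<^sub>\<infinity>k. A (p * k + b) * gauss m z \<tau> (of_int (p * k + b) + \<alpha>))"
    by simp
  moreover have "A (p * k + b) = A b" for k b
    by (metis A mod_mult_self4)
  ultimately show ?thesis
    by (simp add: vartheta_gauss p(2) add.assoc infsum_cmult_right')
qed

lemma gauss_series_mult:
  fixes \<alpha> \<beta> :: real
  assumes \<tau>: "Im \<tau> > 0" and mn: "m > 0" "n > 0" and pr: "p > 0" "r > 0"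
    and A: "\<And>j. A (j mod p) = (A j :: complex)" and B: "\<And>j. B (j mod r) = (B j :: complex)"
  defines "G \<equiv> (\<lambda>N s. A (N - s) * B s
    * gauss (m * n * (m + n)) 0 \<tau> (n * (of_int (N - s) + \<alpha>) - m * (of_int s + \<beta>)))"
  shows "G N summable_on UNIV"
    and "(\<Sum>\<^sub>\<infinity>j::int. A j * gauss m z \<tau> (of_int j + \<alpha>)) * (\<Sum>\<^sub>\<infinity>s::int. B s * gauss n z \<tau> (of_int s + \<beta>)) =
      (\<Sum>\<^sub>\<infinity>N. infsum (G N) UNIV * gauss (m + n) z \<tau> (of_int N + \<alpha> + \<beta>))"
proof -
  note sA = abs_summable_periodic_gauss[OF \<tau> mn(1) pr(1), of A z \<alpha>, OF A]
  note sB = abs_summable_periodic_gauss[OF \<tau> mn(2) pr(2), of B z \<beta>, OF B]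
  have eq: "(A (N - s) * gauss m z \<tau> (of_int (N - s) + \<alpha>)) * (B s * gauss n z \<tau> (of_int s + \<beta>)) =
      G N s * gauss (m + n) z \<tau> (of_int N + \<alpha> + \<beta>)" for N s
  proof -
    have "gauss m z \<tau> (of_int (N - s) + \<alpha>) * gauss n z \<tau> (of_int s + \<beta>) =
        gauss (m + n) z \<tau> (of_int N + \<alpha> + \<beta>)
        * gauss (m * n * (m + n)) 0 \<tau> (n * (of_int (N - s) + \<alpha>) - m * (of_int s + \<beta>))"
      by (subst gauss_mult[OF mn]) (simp add: add_ac)
    then show ?thesis
      by (simp add: G_def mult_ac)
  qed
  \<comment> \<open>This factor is independent of \<open>s\<close> and nonzero, so it can be
    cancelled from the summable convolution.\<close>
  have "gauss (m + n) z \<tau> (of_int N + \<alpha> + \<beta>) \<noteq> 0"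
    by (simp add: gauss_def epow_def)
  then show "G N summable_on UNIV"
    using infsum_convolution(1)[OF sA sB, of N]
    unfolding eq by (simp add: summable_on_cmult_left')
  show "(\<Sum>\<^sub>\<infinity>j::int. A j * gauss m z \<tau> (of_int j + \<alpha>)) * (\<Sum>\<^sub>\<infinity>s::int. B s * gauss n z \<tau> (of_int s + \<beta>)) =
      (\<Sum>\<^sub>\<infinity>N. infsum (G N) UNIV * gauss (m + n) z \<tau> (of_int N + \<alpha> + \<beta>))"
    unfolding infsum_convolution(2)[OF sA sB] eq by (simp only: infsum_cmult_left')
qed

text \<open>The coefficients of a product of expansions of index \<open>m\<close> (shift \<open>\<alpha>\<close>) and \<open>l\<close> (no shift).\<close>

definition conv_coeff ::
    "real \<Rightarrow> int \<Rightarrow> real \<Rightarrow> (int \<Rightarrow> complex) \<Rightarrow> (int \<Rightarrow> complex) \<Rightarrow> complex \<Rightarrow> int \<Rightarrow> complex" where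
  "conv_coeff m l \<alpha> A B \<tau> N = (\<Sum>c=0..<2 * l. A (N - c) * B c
     * theta (of_int l * (m + of_int l) / m) (((m + of_int l) * of_int c - of_int l * (of_int N + \<alpha>)) / m) \<tau>)"

text \<open>Increasing \<open>N\<close> by \<open>p + 2 * l = 2 * (m + l)\<close> changes the theta
  argument by \<open>- 2 * l * (m + l) / m\<close>, exactly minus one period; by
  \<open>p dvd 2 * l\<close> the increase is also a multiple of the period of
  \<open>A\<close>.\<close>

lemma conv_coeff_periodic:
  assumes p: "p > 0" "of_int p = 2 * m" "p dvd 2 * l" and A: "\<And>j. A (j mod p) = A j"
  shows "conv_coeff m l \<alpha> A B \<tau> (N mod (p + 2 * l)) = conv_coeff m l \<alpha> A B \<tau> N"
proof -
  define q where "q = N div (p + 2 * l)"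
  define M where "M = of_int l * (m + of_int l) / m"
  have m: "m > 0"
    using p by linarith
  have N: "N = (N mod (p + 2 * l)) + (p + 2 * l) * q"
    by (simp add: q_def)
  have "A (N - c) = A (N mod (p + 2 * l) - c)" for c
  proof -
    have "p dvd N - N mod (p + 2 * l)"
      using N p(3) by (metis add_diff_cancel_left' dvd_add dvd_mult2 dvd_refl)
    then have "(N - c) mod p = (N mod (p + 2 * l) - c) mod p"
      by (simp add: mod_eq_dvd_iff)
    then show ?thesis
      by (metis A)
  qed
  moreover have "theta M (((m + of_int l) * of_int c - of_int l * (of_int N + \<alpha>)) / m) \<tau> =
      theta M (((m + of_int l) * of_int c - of_int l * (of_int (N mod (p + 2 * l)) + \<alpha>)) / m) \<tau>" for c
  proof -
    have "of_int N = real_of_int (N mod (p + 2 * l)) + 2 * (m + of_int l) * of_int q"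
      by (subst N) (simp only: of_int_add of_int_mult p(2), simp)
    then have "((m + of_int l) * of_int c - of_int l * (of_int N + \<alpha>)) / m =
        ((m + of_int l) * of_int c - of_int l * (of_int (N mod (p + 2 * l)) + \<alpha>)) / m
        + 2 * M * of_int (- q)"
      using m by (simp add: M_def field_simps)
    then show ?thesis
      by (simp only: theta_shift)
  qed
  ultimately show ?thesis
    by (simp add: conv_coeff_def M_def)
qed

text \<open>For fixed \<open>N\<close> the index \<open>s\<close> is split modulo
  \<open>2 * l\<close>. Since \<open>p dvd 2 * l\<close>, both coefficients are constant on each
  class, which therefore contributes a multiple of one theta constant.\<close>

lemma vartheta_sum_mult:
  assumes \<tau>: "Im \<tau> > 0" and p: "p > 0" "of_int p = 2 * m" "p dvd 2 * l" and l: "l > 0"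
    and A: "\<And>j. A (j mod p) = A j" and B: "\<And>j. B (j mod (2 * l)) = B j"
  shows "(\<Sum>b=0..<p. A b * vartheta m (of_int b + \<alpha>) z \<tau>) * (\<Sum>c=0..<2 * l. B c * vartheta (of_int l) (of_int c) z \<tau>) =
    (\<Sum>N=0..<p + 2 * l. conv_coeff m l \<alpha> A B \<tau> N * vartheta (m + of_int l) (of_int N + \<alpha>) z \<tau>)"
proof -
  define M where "M = m * of_int l * (m + of_int l)"
  define G where "G = (\<lambda>N s. A (N - s) * B s
    * gauss M 0 \<tau> (of_int l * (of_int (N - s) + \<alpha>) - m * (of_int s + 0)))"
  have m: "m > 0"
    using p by linarith
  have l': "real_of_int l > 0" "0 < 2 * l"
    using l by simp_all
  note mult = gauss_series_mult[OF \<tau> m l'(1) p(1) l'(2), of A B, OF A B, of _ \<alpha> 0]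
  have summable: "G N summable_on UNIV" for N
    using mult(1)[of N] unfolding G_def M_def .
  have G: "infsum (G N) UNIV = conv_coeff m l \<alpha> A B \<tau> N" for N
  proof -
    have "(\<Sum>\<^sub>\<infinity>k. G N (2 * l * k + c)) = A (N - c) * B c
        * theta (of_int l * (m + of_int l) / m) (((m + of_int l) * of_int c - of_int l * (of_int N + \<alpha>)) / m) \<tau>" for c
    proof -
      have B': "B (2 * l * k + c) = B c" for k
        by (metis B mod_mult_self4)
      have A': "A (N - (2 * l * k + c)) = A (N - c)" for k
      proof -
        have "p dvd (N - (2 * l * k + c)) - (N - c)"
          using p(3) by (simp add: dvd_mult2)
        then show ?thesis
          by (metis A mod_eq_dvd_iff)
      qed
      \<comment> \<open>Up to sign, the Gaussian argument advances by \<open>2 * l * (m + l)\<close>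
        along a class, which is \<open>1 / m\<close> times the step \<open>2 * M\<close>; hence the
        rescaling with \<open>c = 1 / m\<close>.\<close>
      have "G N (2 * l * k + c) = A (N - c) * B c * gauss M 0 \<tau>
          (2 * (1 / m) * M * of_int k + ((m + of_int l) * of_int c - of_int l * (of_int N + \<alpha>)))" for k
      proof -
        have "2 * (1 / m) * M = 2 * of_int l * (m + of_int l)"
          using m by (simp add: M_def)
        then show ?thesis
          unfolding G_def A' B'
          by (subst gauss_zero_minus[symmetric]) (simp add: algebra_simps)
      qed
      then have "(\<Sum>\<^sub>\<infinity>k. G N (2 * l * k + c)) = A (N - c) * B c *
          theta ((1 / m)\<^sup>2 * M) ((1 / m) * ((m + of_int l) * of_int c - of_int l * (of_int N + \<alpha>))) \<tau>"
        using m by (subst theta_scale) (simp_all add: infsum_cmult_right')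
      also have "(1 / m)\<^sup>2 * M = of_int l * (m + of_int l) / m"
        using m by (simp add: M_def power2_eq_square)
      finally show ?thesis
        by simp
    qed
    then show ?thesis
      by (simp add: infsum_residue_classes[OF summable l'(2)] conv_coeff_def)
  qed
  have "(\<Sum>b=0..<p. A b * vartheta m (of_int b + \<alpha>) z \<tau>)
        * (\<Sum>c=0..<2 * l. B c * vartheta (of_int l) (of_int c) z \<tau>) =
      (\<Sum>\<^sub>\<infinity>N. conv_coeff m l \<alpha> A B \<tau> N * gauss (m + of_int l) z \<tau> (of_int N + \<alpha>))"
    using mult(2)[where z = z] sum_vartheta_eq_infsum[OF \<tau> p(1,2), of A \<alpha> z, OF A]
      sum_vartheta_eq_infsum[OF \<tau> l'(2), of "of_int l" B 0 z] B
    unfolding G[symmetric] G_def M_def by simp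
  also have "\<dots> = (\<Sum>N=0..<p + 2 * l. conv_coeff m l \<alpha> A B \<tau> N * vartheta (m + of_int l) (of_int N + \<alpha>) z \<tau>)"
    using l p conv_coeff_periodic[OF p, of A, OF A]
    by (intro sum_vartheta_eq_infsum[symmetric] \<tau>) simp_all
  finally show ?thesis .
qed

section \<open>The half shift and the square of the theta function\<close>

lemma h_one_mod: "h_one (j mod 2) \<tau> = h_one j \<tau>"
proof -
  have "real_of_int (j + 1) = real_of_int ((j mod 2 + 1) + 2 * (j div 2))"
    by (rule arg_cong) simp
  also have "\<dots> = of_int (j mod 2 + 1) + 2 * 1 * of_int (j div 2)"
    by (simp only: of_int_add of_int_mult of_int_numeral mult_1_right)
  finally show ?thesis
    unfolding h_one_def by (simp only: theta_shift)
qed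

lemma h_one_cong: "even (i - j) \<Longrightarrow> h_one i \<tau> = h_one j \<tau>"
  by (metis h_one_mod mod_eq_dvd_iff)

text \<open>The given shift by 1/2 and the one built into the Jacobi theta function combine to the
  factor exp(2 pi i n), which is -1 for every n in 1/2 + Z.\<close>

lemma jacobi_vartheta_half: "jacobi_vartheta (z + 1/2) \<tau> = - vartheta (1/2) (1/2) z \<tau>"
proof -
  have bij: "bij_betw (\<lambda>j::int. of_int j + 1/2) UNIV {n::real. n - 1/2 \<in> \<int>}"
  proof (rule bij_betw_byWitness[where f' = "\<lambda>n. \<lfloor>n - 1/2\<rfloor>"])
    show "\<forall>n\<in>{n::real. n - 1/2 \<in> \<int>}. of_int \<lfloor>n - 1/2\<rfloor> + 1/2 = n"
      by (auto elim!: Ints_cases)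
  qed auto
  define f where "f = (\<lambda>n::real. exp (of_real pi * \<i> * of_real (n\<^sup>2) * \<tau>
    + 2 * of_real pi * \<i> * of_real n * (z + 1/2 + 1/2)))"
  have "f (of_int j + 1/2) = - gauss (1/2) z \<tau> (of_int j + 1/2)" for j :: int
  proof -
    have "exp (2 * of_real pi * \<i> * of_real (of_int j + 1/2)) =
        exp (of_real pi * \<i>) * exp (2 * of_real (of_int j) * of_real pi * \<i>)"
      by (simp add: algebra_simps flip: exp_add)
    also have "\<dots> = -1"
      using exp_integer_2pi[of "of_int j"] by simp
    finally have e: "exp (2 * of_real pi * \<i> * of_real (of_int j + 1/2)) = (-1 :: complex)" .
    have "f x = epow \<tau> (x\<^sup>2 / 2) * epow z x * exp (2 * of_real pi * \<i> * of_real x)" for x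
      by (simp add: f_def epow_def algebra_simps flip: exp_add)
    from this[of "of_int j + 1/2"] show ?thesis
      unfolding e by (simp add: gauss_def)
  qed
  then show ?thesis
    using infsum_reindex_bij_betw[OF bij, of f]
    by (simp add: jacobi_vartheta_def vartheta_gauss f_def infsum_uminus)
qed

text \<open>The product formula \<open>vartheta_sum_mult\<close> wants an integer index in the
  second factor, so this case is computed from \<open>gauss_series_mult\<close>. The two offsets 1/2
  add up to 1, whence the reindexing by \<open>N + 1\<close>.\<close>

lemma vartheta_half_square:
  assumes \<tau>: "Im \<tau> > 0"
  shows "vartheta (1/2) (1/2) z \<tau> ^ 2 = (\<Sum>b=0..<2. h_one b \<tau> * vartheta 1 (of_int b) z \<tau>)"
proof -
  have half: "vartheta (1/2) (1/2) z \<tau> = (\<Sum>\<^sub>\<infinity>j::int. 1 * gauss (1/2) z \<tau> (of_int j + 1/2))"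
    by (simp add: vartheta_gauss)
  have th: "(\<Sum>\<^sub>\<infinity>s::int. gauss (1/4) 0 \<tau> ((1/2) * (of_int (N - s) + 1/2) - (1/2) * (of_int s + 1/2))) =
      h_one (N + 1) \<tau>" for N
  proof -
    \<comment> \<open>The argument is \<open>N / 2 - s\<close> with parameter 1/4. Scaling by 2
      gives \<open>theta 1 (- N)\<close>, which evenness and a shift by the period 2 turn into
      \<open>h_one (N + 1)\<close>.\<close>
    have "(1/2 :: real) * (of_int (N - s) + 1/2) - (1/2) * (of_int s + 1/2) = - (2 * 2 * (1/4) * of_int s + - of_int N / 2)"
      for s :: int
      by (simp add: field_simps)
    then have "(\<Sum>\<^sub>\<infinity>s::int. gauss (1/4) 0 \<tau> ((1/2) * (of_int (N - s) + 1/2) - (1/2) * (of_int s + 1/2))) =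
        theta (2\<^sup>2 * (1/4)) (2 * (- of_int N / 2)) \<tau>"
      by (simp only: gauss_zero_minus theta_scale[of 2, OF zero_neq_numeral[symmetric]])
    also have "\<dots> = theta 1 (of_int N + 2 * 1 * of_int 1) \<tau>"
      unfolding theta_shift by (simp add: theta_minus)
    finally show ?thesis
      by (simp add: h_one_def add_ac)
  qed
  have bij: "bij (\<lambda>N::int. N + 1)"
    by (rule bij_betw_byWitness[where f' = "\<lambda>n. n - 1"]) auto
  have "vartheta (1/2) (1/2) z \<tau> ^ 2 = (\<Sum>\<^sub>\<infinity>N. h_one (N + 1) \<tau> * gauss 1 z \<tau> (of_int (N + 1) + 0))"
    unfolding power2_eq_square half
    using gauss_series_mult(2)[OF \<tau>, of "1/2" "1/2" 1 1 "\<lambda>_. 1" "\<lambda>_. 1" z "1/2" "1/2"] th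
    by (simp add: add_ac)
  also have "\<dots> = (\<Sum>\<^sub>\<infinity>N. h_one N \<tau> * gauss 1 z \<tau> (of_int N + 0))"
    by (rule infsum_reindex_bij_betw[OF bij])
  also have "\<dots> = (\<Sum>b=0..<2. h_one b \<tau> * vartheta 1 (of_int b + 0) z \<tau>)"
    by (rule sum_vartheta_eq_infsum[symmetric]) (use \<tau> h_one_mod in auto)
  finally show ?thesis
    by simp
qed

section \<open>The recursion at integer index\<close>

lemma h_step_cong:
  assumes "\<And>c. 0 \<le> c \<Longrightarrow> c \<le> l \<Longrightarrow> f c = g c" "l > 0"
  shows "h_step l f b \<tau> = h_step l g b \<tau>"
  using assms by (simp add: h_step_def)

text \<open>Negating \<open>b\<close> keeps the parity of the \<open>h_one\<close> indices and,
  theta constants being even, swaps the two of them in each inner summand. In the term for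
  \<open>c = l\<close> the two arguments differ by the full period
  \<open>2 * l * (l + 1)\<close>.\<close>

lemma h_step_minus: "h_step l f (- b) \<tau> = h_step l f b \<tau>"
proof -
  define M where "M = real_of_int (l * (l + 1))"
  have h: "h_one (- b) \<tau> = h_one b \<tau>" "h_one (- b - c) \<tau> = h_one (b - c) \<tau>" for c
    by (rule h_one_cong; simp)+
  have t: "theta M (of_int (- b * l + c)) \<tau> = theta M (of_int (b * l - c)) \<tau>"
    and t': "theta M (of_int (- b * l - c)) \<tau> = theta M (of_int (b * l + c)) \<tau>" for c
    by (metis (no_types, opaque_lifting) theta_minus of_int_minus minus_diff_eq minus_mult_left
        diff_minus_eq_add add.commute uminus_add_conv_diff)+
  have "theta M (of_int (b * l + l * (l + 1))) \<tau> =
      theta M (of_int (b * l - l * (l + 1)) + 2 * M * of_int 1) \<tau>"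
    by (simp add: M_def add.commute)
  then have tl: "theta M (of_int (b * l + l * (l + 1))) \<tau> = theta M (of_int (b * l - l * (l + 1))) \<tau>"
    by (simp only: theta_shift)
  have t0: "theta M (of_int (- b * l)) \<tau> = theta M (of_int (b * l)) \<tau>"
    using t[of 0] by simp
  show ?thesis
    unfolding h_step_def M_def[symmetric] h t t' t0 tl by (simp only: add.commute)
qed

text \<open>Reflecting \<open>c\<close> to \<open>2 * l - c\<close> pairs \<open>1..l - 1\<close>
  with \<open>l + 1..2 * l - 1\<close>, and \<open>F\<close> agrees on each pair, which thus
  collects two theta constants. The values 0 and \<open>l\<close> stay unpaired and give the
  separate terms of \<open>h_step\<close>.\<close>

lemma conv_coeff_one_eq_h_step:
  assumes l: "l > 0" and per: "\<And>j. F (j mod (2 * l)) = F j" and sym: "\<And>j. F (- j) = F j"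
  shows "conv_coeff 1 l 0 (\<lambda>j. h_one j \<tau>) F \<tau> N = h_step l F N \<tau>"
proof -
  define M where "M = real_of_int (l * (l + 1))"
  define T where "T = (\<lambda>c. h_one (N - c) \<tau> * theta M (of_int (N * l - c * (l + 1))) \<tau> * F c)"
  have "theta M (((1 + of_int l) * of_int c - of_int l * (of_int N + 0)) / 1) \<tau> =
      theta M (of_int (N * l - c * (l + 1))) \<tau>" for c
    by (subst theta_minus[symmetric]) (simp add: algebra_simps)
  then have conv: "conv_coeff 1 l 0 (\<lambda>j. h_one j \<tau>) F \<tau> N = sum T {0..<2 * l}"
    by (simp add: conv_coeff_def T_def M_def algebra_simps)
  have refl: "T (2 * l - c) = h_one (N - c) \<tau> * theta M (of_int (N * l + c * (l + 1))) \<tau> * F c" for c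
  proof -
    have "h_one (N - (2 * l - c)) \<tau> = h_one (N - c) \<tau>"
      by (rule h_one_cong) simp
    moreover have "F (2 * l - c) = F c"
      by (metis per sym mod_add_self1 uminus_add_conv_diff add.commute)
    moreover have "theta M (of_int (N * l - (2 * l - c) * (l + 1))) \<tau> =
        theta M (of_int (N * l + c * (l + 1)) + 2 * M * of_int (- 1)) \<tau>"
      by (simp add: M_def algebra_simps)
    ultimately show ?thesis
      unfolding T_def by (simp only: theta_shift)
  qed
  have "{0..<2 * l} = {0, l} \<union> ({1..l - 1} \<union> {l + 1..2 * l - 1})"
    using l by auto
  then have "sum T {0..<2 * l} = T 0 + T l + (sum T {1..l - 1} + sum T {l + 1..2 * l - 1})"
    using l by (simp, subst sum.union_disjoint) auto
  also have "sum T {l + 1..2 * l - 1} = (\<Sum>c=1..l - 1. T (2 * l - c))"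
    by (rule sum.reindex_bij_witness[of _ "\<lambda>c. 2 * l - c" "\<lambda>c. 2 * l - c"]) auto
  also have "sum T {1..l - 1} + (\<Sum>c=1..l - 1. T (2 * l - c)) = (\<Sum>c=1..l - 1. h_one (N - c) \<tau>
      * (theta M (of_int (N * l - c * (l + 1))) \<tau> + theta M (of_int (N * l + c * (l + 1))) \<tau>) * F c)"
    unfolding refl sum.distrib[symmetric] unfolding T_def
    by (rule sum.cong) (simp_all only: distrib_left distrib_right)
  finally show ?thesis
    unfolding conv h_step_def M_def[symmetric] by (simp add: T_def)
qed

text \<open>The recursion only makes sense of \<open>h\<^bsub>l,b\<^esub>\<close> for \<open>0 \<le> b \<le> 2l\<close>; the \<open>2l\<close>-periodic extension satisfies it
  for all integers \<open>b\<close>.\<close>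

definition h_int_per :: "nat \<Rightarrow> complex \<Rightarrow> int \<Rightarrow> complex" where
  "h_int_per l \<tau> b = h_int l (b mod (2 * int l)) \<tau>"

lemma h_int_per_mod: "h_int_per l \<tau> (b mod (2 * int l)) = h_int_per l \<tau> b"
  by (simp add: h_int_per_def)

lemma h_int_per_one: "h_int_per (Suc 0) \<tau> b = h_one b \<tau>"
  by (simp add: h_int_per_def h_one_mod)

lemma h_int_per_Suc:
  assumes "l > 0"
  shows "h_int_per l \<tau> (- b) = h_int_per l \<tau> b"
    and "h_int_per (Suc l) \<tau> b = h_step (int l) (h_int_per l \<tau>) b \<tau>"
proof -
  \<comment> \<open>The recursion is first derived assuming symmetry at level \<open>l\<close>. By
    \<open>h_step_minus\<close> it passes the symmetry on to level \<open>Suc l\<close>, so the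
    induction below removes the assumption.\<close>
  have step: "h_int_per (Suc l) \<tau> b = h_step (int l) (h_int_per l \<tau>) b \<tau>"
    if l: "l > 0" and sym: "\<And>j. h_int_per l \<tau> (- j) = h_int_per l \<tau> j" for l b
  proof -
    define K where "K = (\<lambda>b. h_step (int l) (h_int_per l \<tau>) b \<tau>)"
    define r where "r = b mod (2 * int (Suc l))"
    \<comment> \<open>Periodicity becomes visible once \<open>h_step\<close> is read as a
      convolution coefficient.\<close>
    have K: "K (b mod (2 * int (Suc l))) = K b" for b
    proof -
      have "K b = conv_coeff 1 (int l) 0 (\<lambda>j. h_one j \<tau>) (h_int_per l \<tau>) \<tau> b" for b
        unfolding K_def using l sym h_int_per_mod by (intro conv_coeff_one_eq_h_step[symmetric]) auto
      then show ?thesis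
        using conv_coeff_periodic[of 2 1 "int l" "\<lambda>j. h_one j \<tau>"] by (simp add: h_one_mod)
    qed
    have hl: "h_step (int l) (\<lambda>c. h_int l c \<tau>) b \<tau> = K b" for b
      unfolding K_def using l by (intro h_step_cong) (auto simp: h_int_per_def)
    have r: "0 \<le> r" "r < 2 * int (Suc l)"
      by (simp_all add: r_def)
    \<comment> \<open>For \<open>r > l + 1\<close> the definition evaluates the recursion at
      \<open>2 * l + 2 - r\<close>; periodicity and symmetry identify this with
      \<open>K r\<close>.\<close>
    have "K (2 * int (Suc l) - r) = K (- r)"
      using K[of "2 * int (Suc l) - r"] K[of "- r"] by (metis mod_add_self1 uminus_add_conv_diff add.commute)
    also have "\<dots> = K r"
      by (simp add: K_def h_step_minus)
    finally have refl: "K (2 * int (Suc l) - r) = K r" .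
    obtain k where k: "l = Suc k"
      using l by (cases l) auto
    have "h_int (Suc l) r \<tau> = K r"
      using r hl refl unfolding k h_int.simps Let_def by (simp add: algebra_simps)
    also have "\<dots> = K b"
      unfolding r_def by (rule K)
    finally show ?thesis
      unfolding h_int_per_def r_def K_def .
  qed
  have sym: "h_int_per l \<tau> (- b) = h_int_per l \<tau> b" for b
    using assms
  proof (induction l arbitrary: b rule: nat_induct_non_zero)
    case 1
    show ?case
      by (simp add: h_int_per_one) (rule h_one_cong, simp)
  next
    case (Suc l)
    then show ?case
      by (simp add: step h_step_minus)
  qed
  then show "h_int_per l \<tau> (- b) = h_int_per l \<tau> b" .
  show "h_int_per (Suc l) \<tau> b = h_step (int l) (h_int_per l \<tau>) b \<tau>"
    using assms sym by (rule step)
qed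

section \<open>Even and odd powers\<close>

lemma vartheta_half_even_power:
  assumes \<tau>: "Im \<tau> > 0" and "l > 0"
  shows "vartheta (1/2) (1/2) z \<tau> ^ (2 * l) =
    (\<Sum>b=0..<2 * int l. h_int_per l \<tau> b * vartheta (real l) (of_int b) z \<tau>)"
  using \<open>l > 0\<close>
proof (induction l rule: nat_induct_non_zero)
  case 1
  show ?case
    using vartheta_half_square[OF \<tau>] by (simp add: h_int_per_one)
next
  case (Suc l)
  have "vartheta (1/2) (1/2) z \<tau> ^ (2 * Suc l) =
      (\<Sum>b=0..<2. h_one b \<tau> * vartheta 1 (of_int b + 0) z \<tau>)
      * (\<Sum>c=0..<2 * int l. h_int_per l \<tau> c * vartheta (of_int (int l)) (of_int c) z \<tau>)"
    unfolding mult_Suc_right power_add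
    using vartheta_half_square[OF \<tau>, of z] Suc.IH by simp
  also have "\<dots> = (\<Sum>N=0..<2 + 2 * int l. conv_coeff 1 (int l) 0 (\<lambda>j. h_one j \<tau>) (h_int_per l \<tau>) \<tau> N
      * vartheta (1 + of_int (int l)) (of_int N + 0) z \<tau>)"
    by (rule vartheta_sum_mult) (use \<tau> Suc.hyps h_one_mod h_int_per_mod in auto)
  moreover have "conv_coeff 1 (int l) 0 (\<lambda>j. h_one j \<tau>) (h_int_per l \<tau>) \<tau> N = h_int_per (Suc l) \<tau> N" for N
    using Suc.hyps h_int_per_mod
    by (subst conv_coeff_one_eq_h_step) (auto simp: h_int_per_Suc)
  ultimately show ?case
    by simp
qed

text \<open>The additional factor is a one-term combination with \<open>p = 1\<close> and
  \<open>m = 1/2\<close>. Then the theta parameter \<open>l * (m + l) / m\<close> becomes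
  \<open>l * (2 * l + 1)\<close> and the argument \<open>c * (2 * l + 1) - l * (2 * N + 1)\<close>,
  as in \<open>h_half\<close>.\<close>

lemma vartheta_half_odd_power:
  assumes \<tau>: "Im \<tau> > 0" and l: "l > 0"
  shows "vartheta (1/2) (1/2) z \<tau> ^ (2 * l + 1) =
    (\<Sum>b=0..<2 * int l + 1. h_half l b \<tau> * vartheta (real l + 1/2) (of_int b + 1/2) z \<tau>)"
proof -
  have "vartheta (1/2) (1/2) z \<tau> ^ (2 * l + 1) =
      (\<Sum>b=0..<1. 1 * vartheta (1/2) (of_int b + 1/2) z \<tau>)
      * (\<Sum>c=0..<2 * int l. h_int_per l \<tau> c * vartheta (of_int (int l)) (of_int c) z \<tau>)"
  proof -
    have "{0..<1::int} = {0}"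
      by auto
    then show ?thesis
      using vartheta_half_even_power[OF assms, of z] by simp
  qed
  also have "\<dots> = (\<Sum>N=0..<1 + 2 * int l. conv_coeff (1/2) (int l) (1/2) (\<lambda>_. 1) (h_int_per l \<tau>) \<tau> N
      * vartheta (1/2 + of_int (int l)) (of_int N + 1/2) z \<tau>)"
    by (rule vartheta_sum_mult) (use assms h_int_per_mod in auto)
  moreover have "conv_coeff (1/2) (int l) (1/2) (\<lambda>_. 1) (h_int_per l \<tau>) \<tau> N = h_half l N \<tau>" for N
    unfolding conv_coeff_def h_half_def
    by (intro sum.cong) (auto simp: h_int_per_def algebra_simps)
  ultimately show ?thesis
    by (simp add: add.commute)
qed

theorem theorem2:
  fixes l \<delta> :: nat and z \<tau> :: complex
  assumes "Im \<tau> > 0" and "l > 0" and "\<delta> \<in> {0, 1}"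
  shows "(-1) ^ \<delta> * jacobi_vartheta (z + 1/2) \<tau> ^ (2 * l + \<delta>) =
    (\<Sum>b = 0..2 * l + \<delta> - 1.
       h (real l + real \<delta> / 2) (real b + real \<delta> / 2) \<tau>
       * vartheta (real l + real \<delta> / 2) (real b + real \<delta> / 2) z \<tau>)"
proof -
  \<comment> \<open>Positivity matters: for \<open>n = 0\<close> the truncated bound
    \<open>n - 1\<close> would keep the term at 0.\<close>
  have sum: "(\<Sum>b=0..<int n. f b) = (\<Sum>b=0..n - 1. f (int b))" if "n > 0" for n and f :: "int \<Rightarrow> complex"
    by (rule sum.reindex_bij_witness[of _ int nat]) (use that in auto)
  consider "\<delta> = 0" | "\<delta> = 1"
    using assms(3) by auto
  then show ?thesis
  proof cases
    case 1
    have "vartheta (1/2) (1/2) z \<tau> ^ (2 * l) =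
        (\<Sum>b=0..2 * l - 1. h_int_per l \<tau> (int b) * vartheta (real l) (real b) z \<tau>)"
      using vartheta_half_even_power[OF assms(1,2), of z] sum[of "2 * l"] assms(2) by simp
    also have "\<dots> = (\<Sum>b=0..2 * l - 1. h (real l) (real b) \<tau> * vartheta (real l) (real b) z \<tau>)"
      by (intro sum.cong refl) (use assms(2) in \<open>auto simp: h_def h_int_per_def\<close>)
    finally show ?thesis
      by (simp add: 1 jacobi_vartheta_half)
  next
    case 2
    have fl: "\<lfloor>real n + 1/2\<rfloor> = int n" for n
      by linarith
    have "real l + 1/2 \<notin> \<int>"
    proof
      assume "real l + 1/2 \<in> \<int>"
      then obtain i :: int where "real l + 1/2 = of_int i"
        by (elim Ints_cases)
      then have "real_of_int (2 * int l + 1) = of_int (2 * i)"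
        by simp
      then have "2 * int l + 1 = 2 * i"
        by (simp only: of_int_eq_iff)
      then show False
        by presburger
    qed
    then have "h (real l + 1/2) (real b + 1/2) \<tau> = h_half l (int b) \<tau>" for b
      by (simp add: h_def fl)
    then show ?thesis
      using vartheta_half_odd_power[OF assms(1,2), of z] sum[of "2 * l + 1"]
      by (simp add: 2 jacobi_vartheta_half add.commute)
  qed
qed

end
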